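(* Let $f$ be a holomorphic Hecke eigenform of weight $k$ for $SL(2,\mathbb{Z})$ with Fourier expansion $f(z)=\sum_{n\ge1}\lambda_f(n)n^{\frac{k-1}{2}}e(nz)$, $\lambda_f(1)=1$. Fix $0\le\theta<1$ and $\varepsilon>0$. Then for any $\alpha,\beta\in\mathbb{R}$ and all sufficiently large $N$, $$\sum_{n\le N}\lambda_f(n)e(\beta n^\theta+\alpha n)\ll N^{1/2+\theta/2+\varepsilon},$$ where the implied constant depends only on $\beta,\theta,\varepsilon$ and $f$ (in particular not on $\alpha$).
   Context: $e(z)=e^{2\pi iz}$. *)

theory Defs
  imports "HOL-Complex_Analysis.Complex_Analysis"
begin

definition e2pi :: "complex \<Rightarrow> complex" where
  "e2pi z = exp (2 * of_real pi * \<i> * z)"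

definition upper_half_plane :: "complex set" where
  "upper_half_plane = {z. Im z > 0}"

text \<open>
  Functions on the upper half-plane are total functions on \<open>complex\<close>; their values elsewhere are
  never referred to.  The last clause is holomorphy at the cusp: for a 1-periodic holomorphic
  function on the upper half-plane, boundedness near \<open>\<i>\<infinity>\<close> says exactly that its Fourier expansion
  has no terms of negative index.
\<close>

definition modular_form :: "int \<Rightarrow> (complex \<Rightarrow> complex) \<Rightarrow> bool" where
  "modular_form k f \<longleftrightarrow>
     f holomorphic_on upper_half_plane \<and>
     (\<forall>a b c d :: int. a * d - b * c = 1 \<longrightarrow>
        (\<forall>z\<in>upper_half_plane.
           f ((of_int a * z + of_int b) / (of_int c * z + of_int d)) =
             (of_int c * z + of_int d) powi k * f z)) \<and>
     (\<exists>A B. \<forall>z\<in>upper_half_plane. Im z \<ge> A \<longrightarrow> norm (f z) \<le> B)"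

text \<open>
  The Hecke operator \<open>T\<^sub>n\<close> (for \<open>n \<ge> 1\<close>) in weight \<open>k\<close>:
  \<open>(T\<^sub>n f)(z) = n\<^bsup>k-1\<^esup> \<Sum>\<^bsub>ad=n\<^esub> \<Sum>\<^bsub>0\<le>b<d\<^esub> d\<^bsup>-k\<^esup> f((az+b)/d)\<close>.
  Rescaling \<open>T\<^sub>n\<close> by a nonzero constant (other normalisations in use) does not affect its
  eigenfunctions.
\<close>

definition hecke_operator :: "int \<Rightarrow> nat \<Rightarrow> (complex \<Rightarrow> complex) \<Rightarrow> complex \<Rightarrow> complex" where
  "hecke_operator k n f z =
     of_nat n powi (k - 1) *
       (\<Sum>d | d dvd n. \<Sum>b<d.
          of_nat d powi (- k) * f ((of_nat (n div d) * z + of_nat b) / of_nat d))"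

definition hecke_eigenform :: "int \<Rightarrow> (complex \<Rightarrow> complex) \<Rightarrow> bool" where
  "hecke_eigenform k f \<longleftrightarrow>
     modular_form k f \<and>
     (\<exists>z\<in>upper_half_plane. f z \<noteq> 0) \<and>
     (\<forall>n\<ge>1. \<exists>c. \<forall>z\<in>upper_half_plane. hecke_operator k n f z = c * f z)"

end

theory Submission
  imports Defs
begin

text \<open>
  Write \<open>e(x) = exp(2 \<pi> i x)\<close>.  Only modularity and vanishing at the cusp are used: \<open>Im(z)\<^bsup>k/2\<^esup> |f(z)|\<close> is
  invariant under \<open>SL(2,\<int>)\<close>, and bounded where \<open>Im z \<ge> 1/5\<close> by exponential decay, so
  \<open>f(x + i/M) = O(M\<^bsup>k/2\<^esup>)\<close> uniformly in \<open>x\<close>.  For \<open>M/2 < n \<le> M\<close>, the summand is the Fourier coefficient of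
  \<open>x \<mapsto> f(x + i/M)\<close> times \<open>e(\<alpha> n)\<close> times a weight \<open>g(n)\<close> of size \<open>A = O(M\<^bsup>-(k-1)/2\<^esup>)\<close> with increments
  \<open>O(A M\<^bsup>\<theta>-1\<^esup>)\<close>.  A dyadic block is therefore at most \<open>O(M\<^bsup>k/2\<^esup>)\<close> times the \<open>L\<^sup>1\<close> norm of
  \<open>\<Sum> g(n) e(n x)\<close> over a period, whatever \<open>\<alpha>\<close> is, and this norm is \<open>O(A (M\<^bsup>\<theta>/2\<^esup> + log M))\<close>.
\<close>

section \<open>Integrals of trigonometric polynomials over a period\<close>

text \<open>The period is centred at 0 because the lower bound \<open>4 * |x|\<close> for
  \<open>|1 - e(x)|\<close>, used later under the integral, requires
  \<open>|x| <= 1/2\<close>.\<close>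

lemma cis_orthogonality:
  fixes n :: int
  shows "((\<lambda>x. cis (2 * pi * (of_int n * x))) has_integral (if n = 0 then 1 else 0)) {-1/2..1/2}"
proof (cases "n = 0")
  case True
  then show ?thesis using has_integral_const_real[of "1::complex" "-1/2" "1/2"] by simp
next
  case False
  define w where "w = 2 * complex_of_real pi * \<i> * of_int n"
  have w: "w \<noteq> 0" using False by (simp add: w_def)
  have eq: "cis (2 * pi * (of_int n * x)) = exp (w * of_real x)" for x :: real
    by (simp add: cis_conv_exp w_def mult_ac)
  have "((\<lambda>x. exp (w * of_real x)) has_integral
      (exp (w * of_real (1/2)) / w - exp (w * of_real (-1/2)) / w)) {-1/2..1/2}"
  proof (rule fundamental_theorem_of_calculus)
    fix x :: real
    show "((\<lambda>x. exp (w * of_real x) / w) has_vector_derivative exp (w * of_real x))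
        (at x within {-1/2..1/2})"
      by (rule has_vector_derivative_real_field[of "\<lambda>z. exp (w * z) / w"])
        (auto intro!: derivative_eq_intros simp: w)
  qed auto
  moreover have "exp (w * of_real (1/2)) = exp (w * of_real (-1/2))"
  proof -
    have "exp (w * of_real (1/2)) = exp (w * of_real (-1/2) + w)"
      by (simp add: field_simps)
    also have "\<dots> = exp (w * of_real (-1/2))"
    proof -
      have "exp w = 1"
        using exp_integer_2pi[of "of_int n"] by (simp add: w_def mult_ac)
      then show ?thesis by (simp only: exp_add mult_1_right)
    qed
    finally show ?thesis .
  qed
  ultimately show ?thesis using False by (simp add: eq)
qed

text \<open>Only the diagonal frequencies \<open>n = m\<close> survive integration. Two coefficient
  families and two index sets are kept so that the same identity yields Parseval (conjugate
  coefficients, equal sets) and the convolution with a truncated Fourier series.\<close>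

lemma trig_poly_product_integral:
  fixes a b :: "nat \<Rightarrow> complex"
  assumes "finite P" "finite S"
  shows "((\<lambda>x. (\<Sum>m\<in>P. a m * cis (- (2 * pi * (real m * x)))) * (\<Sum>n\<in>S. b n * cis (2 * pi * (real n * x))))
     has_integral (\<Sum>n\<in>P \<inter> S. a n * b n)) {-1/2..1/2}"
proof -
  have "((\<lambda>x. \<Sum>m\<in>P. \<Sum>n\<in>S. a m * b n * cis (2 * pi * (of_int (int n - int m) * x)))
      has_integral (\<Sum>m\<in>P. \<Sum>n\<in>S. a m * b n * (if int n - int m = 0 then 1 else 0))) {-1/2..1/2}"
    by (intro has_integral_sum has_integral_mult_right cis_orthogonality assms)
  moreover have "(\<Sum>m\<in>P. \<Sum>n\<in>S. a m * b n * (if int n - int m = 0 then 1 else 0)) = (\<Sum>n\<in>P \<inter> S. a n * b n)"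
    using assms by (simp add: if_distrib sum.delta sum.inter_restrict cong: if_cong)
  moreover have "(\<Sum>m\<in>P. \<Sum>n\<in>S. a m * b n * cis (2 * pi * (of_int (int n - int m) * x))) =
     (\<Sum>m\<in>P. a m * cis (- (2 * pi * (real m * x)))) * (\<Sum>n\<in>S. b n * cis (2 * pi * (real n * x)))" for x
    unfolding sum_product
  proof (intro sum.cong refl)
    fix m n
    have "cis (2 * pi * (of_int (int n - int m) * x)) = cis (- (2 * pi * (real m * x))) * cis (2 * pi * (real n * x))"
      by (simp add: cis_mult algebra_simps)
    then show "a m * b n * cis (2 * pi * (of_int (int n - int m) * x)) =
       a m * cis (- (2 * pi * (real m * x))) * (b n * cis (2 * pi * (real n * x)))" by simp
  qed
  ultimately show ?thesis by simp
qed

lemma trig_poly_parseval: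
  fixes g :: "nat \<Rightarrow> complex"
  assumes "finite S"
  shows "((\<lambda>x. (norm (\<Sum>n\<in>S. g n * cis (2 * pi * (real n * x))))\<^sup>2)
     has_integral (\<Sum>n\<in>S. (norm (g n))\<^sup>2)) {-1/2..1/2}"
proof -
  have "((\<lambda>x. Re ((\<Sum>m\<in>S. cnj (g m) * cis (- (2 * pi * (real m * x)))) * (\<Sum>n\<in>S. g n * cis (2 * pi * (real n * x)))))
     has_integral Re (\<Sum>n\<in>S \<inter> S. cnj (g n) * g n)) {-1/2..1/2}"
    by (intro has_integral_Re trig_poly_product_integral assms)
  moreover have "(\<Sum>m\<in>S. cnj (g m) * cis (- (2 * pi * (real m * x)))) * (\<Sum>n\<in>S. g n * cis (2 * pi * (real n * x))) =
      of_real ((norm (\<Sum>n\<in>S. g n * cis (2 * pi * (real n * x))))\<^sup>2)" for x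
    unfolding complex_norm_square by (subst mult.commute) (simp add: cis_cnj)
  moreover have "(\<Sum>n\<in>S \<inter> S. cnj (g n) * g n) = of_real (\<Sum>n\<in>S. (norm (g n))\<^sup>2)"
    unfolding of_real_sum complex_norm_square by (simp add: mult.commute)
  ultimately show ?thesis by (simp only: Re_complex_of_real)
qed

lemma norm_trig_poly_integrable:
  fixes g :: "nat \<Rightarrow> complex"
  shows "(\<lambda>x. norm (\<Sum>n\<in>S. g n * cis (2 * pi * (real n * x)))) integrable_on {a..b}"
  by (intro integrable_continuous_real continuous_intros)

text \<open>The twisted sum is the convolution of the two polynomials, evaluated at \<open>t\<close>.\<close>

lemma coefficient_twist_bound:
  fixes c g :: "nat \<Rightarrow> complex"
  assumes P: "finite P" "S \<subseteq> P"
    and B: "\<And>x::real. norm (\<Sum>n\<in>P. c n * cis (2 * pi * (real n * x))) \<le> B"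
  shows "norm (\<Sum>n\<in>S. c n * g n * cis (2 * pi * (real n * t)))
    \<le> B * integral {-1/2..1/2} (\<lambda>x. norm (\<Sum>n\<in>S. g n * cis (2 * pi * (real n * x))))"
proof -
  let ?F = "\<lambda>x. \<Sum>m\<in>P. (c m * cis (2 * pi * (real m * t))) * cis (- (2 * pi * (real m * x)))"
  let ?G = "\<lambda>x. \<Sum>n\<in>S. g n * cis (2 * pi * (real n * x))"
  have S: "finite S" using P finite_subset by blast
  have *: "((\<lambda>x. ?F x * ?G x) has_integral (\<Sum>n\<in>P \<inter> S. c n * cis (2 * pi * (real n * t)) * g n)) {-1/2..1/2}"
    by (intro trig_poly_product_integral P S)
  \<comment> \<open>\<open>?F x\<close> is the polynomial with coefficients \<open>c\<close> at the
    point \<open>t - x\<close>. As \<open>B\<close> bounds it at every point, the twist by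
    \<open>t\<close> costs nothing; this is the source of uniformity in \<alpha>.\<close>
  have FB: "norm (?F x) \<le> B" for x
    using B[of "t - x"] by (simp add: mult.assoc cis_mult algebra_simps)
  have "norm (integral {-1/2..1/2} (\<lambda>x. ?F x * ?G x)) \<le> integral {-1/2..1/2} (\<lambda>x. B * norm (?G x))"
  proof (rule integral_norm_bound_integral)
    show "(\<lambda>x. ?F x * ?G x) integrable_on {-1/2..1/2}" using * by blast
    show "(\<lambda>x. B * norm (?G x)) integrable_on {-1/2..1/2}"
      by (intro integrable_continuous_real continuous_intros)
    show "norm (?F x * ?G x) \<le> B * norm (?G x)" for x
      by (simp only: norm_mult) (intro mult_right_mono FB norm_ge_zero)
  qed
  moreover have "P \<inter> S = S" using P by blast
  ultimately show ?thesis using integral_unique[OF *]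
    by (simp add: mult_ac)
qed

section \<open>The L1 norm of an exponential sum with slowly varying coefficients\<close>

lemma has_integral_even_extension:
  fixes h :: "real \<Rightarrow> real"
  assumes "(h has_integral J) {0..c}" "0 \<le> c"
  shows "((\<lambda>x. h \<bar>x\<bar>) has_integral 2 * J) {-c..c}"
proof -
  have 1: "((\<lambda>x. h \<bar>x\<bar>) has_integral J) {0..c}"
    using assms(1) by (rule has_integral_eq[rotated]) simp
  have "((\<lambda>x. h (-x)) has_integral J) {-c..0}"
    using assms(1) has_integral_reflect_real[of h J c 0] by simp
  then have "((\<lambda>x. h \<bar>x\<bar>) has_integral J) {-c..0}"
    by (rule has_integral_eq[rotated]) simp
  from has_integral_combine[OF _ _ this 1] show ?thesis using assms(2) by simp
qed

text \<open>Integrates the contribution of the two boundary terms of summation by parts; this is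
  where the logarithm arises.\<close>

lemma has_integral_inverse_affine_abs:
  fixes s :: real
  assumes "0 < s"
  shows "((\<lambda>x. 1 / (s + 4 * \<bar>x\<bar>)) has_integral ln (1 + 2 / s) / 2) {-1/2..1/2}"
proof -
  have "((\<lambda>x. 1 / (s + 4 * x)) has_integral (ln (s + 4 * (1/2)) / 4 - ln (s + 4 * 0) / 4)) {0..1/2}"
    using assms
    by (intro fundamental_theorem_of_calculus)
      (auto simp: has_real_derivative_iff_has_vector_derivative[symmetric] divide_simps
        intro!: derivative_eq_intros)
  from has_integral_even_extension[OF this]
  have "((\<lambda>x. 1 / (s + 4 * \<bar>x\<bar>)) has_integral 2 * (ln (s + 2) / 4 - ln s / 4)) {-1/2..1/2}"
    by simp
  moreover have "ln (1 + 2 / s) / 2 = 2 * (ln (s + 2) / 4 - ln s / 4)"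
  proof -
    have "1 + 2 / s = (s + 2) / s" using assms by (simp add: field_simps)
    then show ?thesis using assms by (simp add: ln_div)
  qed
  ultimately show ?thesis by (simp only:)
qed

text \<open>The weight paired with Parseval; its integral is at most
  \<open>1 / (2 * s)\<close>.\<close>

lemma has_integral_inverse_affine_abs_square:
  fixes s :: real
  assumes "0 < s"
  shows "((\<lambda>x. 1 / (s + 4 * \<bar>x\<bar>)\<^sup>2) has_integral (1 / s - 1 / (s + 2)) / 2) {-1/2..1/2}"
proof -
  have "((\<lambda>x. 1 / (s + 4 * x)\<^sup>2) has_integral (- (1/4) * inverse (s + 4 * (1/2)) - - (1/4) * inverse (s + 4 * 0))) {0..1/2}"
  proof (rule fundamental_theorem_of_calculus)
    fix x :: real assume "x \<in> {0..1/2}"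
    then have "s + 4 * x \<noteq> 0" using assms by auto
    then have "((\<lambda>x. - (1/4) * inverse (s + 4 * x)) has_real_derivative
        - (1/4) * - (inverse (s + 4 * x) * 4 * inverse (s + 4 * x))) (at x within {0..1/2})"
      by (intro DERIV_cmult DERIV_inverse') (auto intro!: derivative_eq_intros)
    moreover have "- (1/4) * - (inverse (s + 4 * x) * 4 * inverse (s + 4 * x)) = 1 / (s + 4 * x)\<^sup>2"
      by (simp add: power2_eq_square inverse_eq_divide)
    ultimately have "((\<lambda>x. - (1/4) * inverse (s + 4 * x)) has_real_derivative 1 / (s + 4 * x)\<^sup>2) (at x within {0..1/2})"
      by (simp only:)
    then show "((\<lambda>x. - (1/4) * inverse (s + 4 * x)) has_vector_derivative 1 / (s + 4 * x)\<^sup>2) (at x within {0..1/2})"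
      by (simp only: has_real_derivative_iff_has_vector_derivative)
  qed simp
  from has_integral_even_extension[OF this]
  have "((\<lambda>x. 1 / (s + 4 * \<bar>x\<bar>)\<^sup>2) has_integral 2 * (- (1/4) * inverse (s + 2) - - (1/4) * inverse s)) {-1/2..1/2}"
    by simp
  moreover have "2 * (- (1/4) * inverse (s + 2) - - (1/4) * inverse s) = (1 / s - 1 / (s + 2)) / 2"
  proof -
    have "2 * (- (1/4) * u - - (1/4) * v) = (v - u) / 2" for u v :: real by simp
    then show ?thesis by (simp only: inverse_eq_divide)
  qed
  ultimately show ?thesis by (simp only:)
qed

text \<open>Sine is concave on this interval and so lies above its chord.\<close>

lemma jordan_sin_lower:
  fixes y :: real
  assumes "0 \<le> y" "y \<le> pi / 2"
  shows "2 / pi * y \<le> sin y"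
proof -
  have "convex_on {0..pi/2} (\<lambda>x. - sin x)"
    by (rule f''_ge0_imp_convex[where f' = "\<lambda>x. - cos x" and f'' = "\<lambda>x. sin x"])
      (auto intro!: derivative_eq_intros sin_ge_zero)
  from convex_onD[OF this, of "2 / pi * y" 0 "pi / 2"]
  show ?thesis using assms by (simp add: field_simps)
qed

lemma norm_one_minus_cis_ge:
  fixes x :: real
  assumes "\<bar>x\<bar> \<le> 1/2"
  shows "4 * \<bar>x\<bar> \<le> norm (1 - cis (2 * pi * x))"
proof -
  have "norm (1 - cis (2 * pi * x)) = 2 * \<bar>sin (pi * x)\<bar>"
    using dist_exp_i_1[of "2 * pi * x"] by (simp add: cis_conv_exp norm_minus_commute)
  moreover have "\<bar>sin (pi * x)\<bar> = sin (pi * \<bar>x\<bar>)"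
  proof -
    have "\<bar>sin (pi * x)\<bar> = \<bar>sin (pi * \<bar>x\<bar>)\<bar>" by (cases "x \<ge> 0") auto
    also have "\<dots> = sin (pi * \<bar>x\<bar>)"
    proof (intro abs_of_nonneg sin_ge_zero)
      have "pi * \<bar>x\<bar> \<le> pi * 1" using assms by (intro mult_left_mono) auto
      then show "pi * \<bar>x\<bar> \<le> pi" by simp
    qed simp
    finally show ?thesis .
  qed
  moreover have "2 / pi * (pi * \<bar>x\<bar>) \<le> sin (pi * \<bar>x\<bar>)"
    using assms by (intro jordan_sin_lower) (auto simp: field_simps)
  ultimately show ?thesis by simp
qed

text \<open>Abel summation, arranged so that differences occur only for \<open>a < n < b\<close>,
  where both \<open>n\<close> and \<open>Suc n\<close> lie in the range of summation.\<close>

lemma power_sum_by_parts: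
  fixes g :: "nat \<Rightarrow> 'a :: comm_ring_1"
  assumes "a < b"
  shows "(1 - z) * (\<Sum>n\<in>{a<..b}. g n * z ^ n) =
     g (Suc a) * z ^ Suc a - g b * z ^ Suc b + z * (\<Sum>n\<in>{a<..<b}. (g (Suc n) - g n) * z ^ n)"
proof -
  obtain d where b: "b = Suc (a + d)" using assms less_imp_Suc_add by blast
  show ?thesis unfolding b
  proof (induction d)
    case 0
    have "{a<..Suc a} = {Suc a}" "{a<..<Suc a} = {}" by auto
    then show ?case by (simp add: algebra_simps)
  next
    case (Suc d)
    have "{a<..Suc (a + Suc d)} = insert (Suc (a + Suc d)) {a<..Suc (a + d)}"
      "{a<..<Suc (a + Suc d)} = insert (Suc (a + d)) {a<..<Suc (a + d)}" by auto
    then show ?case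
      by (simp add: distrib_left Suc.IH) (simp add: algebra_simps)
  qed
qed

text \<open>
  Cauchy--Schwarz alone loses a factor \<open>1 / sqrt s\<close>.  Summation by parts and \<open>|1 - e(x)| \<ge> 4 |x|\<close> give
  \<open>(s + 4 |x|) |G| \<le> s |G| + |H| + 2 A\<close> with \<open>H\<close> the polynomial of differences; then Parseval is applied
  against the integrable weight \<open>(s + 4 |x|)\<^sup>-\<^sup>2\<close>.
\<close>

lemma trig_poly_L1_bound:
  fixes g :: "nat \<Rightarrow> complex" and A s :: real
  assumes "a < b" "0 < s" "0 < A"
    and gA: "\<And>n. a < n \<Longrightarrow> n \<le> b \<Longrightarrow> norm (g n) \<le> A"
    and dA: "\<And>n. a < n \<Longrightarrow> n < b \<Longrightarrow> norm (g (Suc n) - g n) \<le> A * s"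
  shows "integral {-1/2..1/2} (\<lambda>x. norm (\<Sum>n\<in>{a<..b}. g n * cis (2 * pi * (real n * x))))
    \<le> A * (sqrt (2 * s * real (b - a)) + ln (1 + 2 / s))"
proof -
  define L where "L = real (b - a)"
  have L: "L > 0" using assms by (simp add: L_def)
  \<comment> \<open>After integration the Parseval term is at most
    \<open>2 * A * s^2 * L / \<kappa>\<close> and the weight term at most
    \<open>A * \<kappa> / (4 * s)\<close>; they agree when
    \<open>\<kappa>^2 = 8 * s^3 * L\<close>.\<close>
  define \<kappa> where "\<kappa> = s * sqrt (8 * s * L)"
  have \<kappa>: "\<kappa> > 0" using assms L by (simp add: \<kappa>_def)
  define G where "G = (\<lambda>x::real. norm (\<Sum>n\<in>{a<..b}. g n * cis (2 * pi * (real n * x))))"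
  define H where "H = (\<lambda>x::real. norm (\<Sum>n\<in>{a<..<b}. (g (Suc n) - g n) * cis (2 * pi * (real n * x))))"
  let ?I = "{-1/2..1/2::real}"
  \<comment> \<open>A pointwise majorant of \<open>G\<close> on the period, built from three pieces
    with known integrals: squares for Parseval and the two weights.\<close>
  define J where "J = (\<lambda>x. (s\<^sup>2 * (G x)\<^sup>2 + (H x)\<^sup>2) / (A * \<kappa>) + A * \<kappa> / 2 * (1 / (s + 4 * \<bar>x\<bar>)\<^sup>2) + 2 * A * (1 / (s + 4 * \<bar>x\<bar>)))"
  have cis_power: "cis (2 * pi * (real n * x)) = cis (2 * pi * x) ^ n" for n x
    by (simp add: Complex.DeMoivre mult_ac)
  have pointwise: "G x \<le> J x" if "x \<in> ?I" for x
  proof -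
    define w where "w = s + 4 * \<bar>x\<bar>"
    have w: "w > 0" using assms by (simp add: w_def add_pos_nonneg)
    have "4 * \<bar>x\<bar> * G x \<le> norm (1 - cis (2 * pi * x)) * G x"
      using that by (intro mult_right_mono norm_one_minus_cis_ge) (auto simp: G_def)
    also have "\<dots> = norm (g (Suc a) * cis (2 * pi * x) ^ Suc a - g b * cis (2 * pi * x) ^ Suc b
        + cis (2 * pi * x) * (\<Sum>n\<in>{a<..<b}. (g (Suc n) - g n) * cis (2 * pi * x) ^ n))"
      unfolding G_def norm_mult[symmetric] cis_power power_sum_by_parts[OF \<open>a < b\<close>] ..
    also have "\<dots> \<le> norm (g (Suc a) * cis (2 * pi * x) ^ Suc a) + norm (g b * cis (2 * pi * x) ^ Suc b)
        + norm (cis (2 * pi * x) * (\<Sum>n\<in>{a<..<b}. (g (Suc n) - g n) * cis (2 * pi * x) ^ n))"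
      by (intro order.trans[OF norm_triangle_ineq] add_right_mono norm_triangle_ineq4)
    also have "\<dots> = norm (g (Suc a)) + norm (g b) + H x"
      by (simp add: H_def norm_mult norm_power cis_power del: power_Suc)
    also have "\<dots> \<le> 2 * A + H x" using gA[of "Suc a"] gA[of b] assms(1) by (simp add: Suc_le_eq)
    \<comment> \<open>Adding \<open>s * G x\<close> to both sides makes the factor \<open>w\<close>
      at least \<open>s\<close>, so that dividing by it is harmless even at
      \<open>x = 0\<close>.\<close>
    finally have wG: "w * G x \<le> s * G x + H x + 2 * A" by (simp add: w_def algebra_simps)
    define p where "p = s * G x + H x"
    have "G x \<le> p / w + 2 * A * (1 / w)"
      using wG w by (simp add: p_def field_simps)
    \<comment> \<open>AM-GM; \<open>\<kappa>\<close> balances the two terms after integration\<close>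
    also have "p / w \<le> p\<^sup>2 / (2 * (A * \<kappa>)) + A * \<kappa> / 2 * (1 / w\<^sup>2)"
    proof -
      have "0 \<le> (p - A * \<kappa> / w)\<^sup>2 / (2 * (A * \<kappa>))" using \<kappa> assms by simp
      also have "\<dots> = p\<^sup>2 / (2 * (A * \<kappa>)) + A * \<kappa> / 2 * (1 / w\<^sup>2) - p / w"
        using \<kappa> assms w by (simp add: power2_eq_square field_simps)
      finally show ?thesis by simp
    qed
    \<comment> \<open>\<open>(u + v)^2 <= 2 * (u^2 + v^2)\<close> separates \<open>G\<close> from
      \<open>H\<close>, so that Parseval applies to each.\<close>
    also have "p\<^sup>2 / (2 * (A * \<kappa>)) \<le> (2 * (s\<^sup>2 * (G x)\<^sup>2 + (H x)\<^sup>2)) / (2 * (A * \<kappa>))"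
    proof (rule divide_right_mono)
      have "0 \<le> (s * G x - H x)\<^sup>2" by simp
      then show "p\<^sup>2 \<le> 2 * (s\<^sup>2 * (G x)\<^sup>2 + (H x)\<^sup>2)"
        unfolding p_def power2_eq_square by (simp add: algebra_simps)
    qed (use \<kappa> assms in simp)
    also have "\<dots> = (s\<^sup>2 * (G x)\<^sup>2 + (H x)\<^sup>2) / (A * \<kappa>)"
      by (rule mult_divide_mult_cancel_left) simp
    finally show ?thesis by (simp add: J_def w_def)
  qed
  have G2: "((\<lambda>x. (G x)\<^sup>2) has_integral (\<Sum>n\<in>{a<..b}. (norm (g n))\<^sup>2)) ?I"
    unfolding G_def by (rule trig_poly_parseval) simp
  have H2: "((\<lambda>x. (H x)\<^sup>2) has_integral (\<Sum>n\<in>{a<..<b}. (norm (g (Suc n) - g n))\<^sup>2)) ?I"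
    unfolding H_def by (rule trig_poly_parseval) simp
  let ?v = "(s\<^sup>2 * (\<Sum>n\<in>{a<..b}. (norm (g n))\<^sup>2) + (\<Sum>n\<in>{a<..<b}. (norm (g (Suc n) - g n))\<^sup>2)) / (A * \<kappa>)
    + A * \<kappa> / 2 * ((1 / s - 1 / (s + 2)) / 2) + 2 * A * (ln (1 + 2 / s) / 2)"
  have J: "(J has_integral ?v) ?I"
    unfolding J_def
    by (intro has_integral_add has_integral_mult_right has_integral_divide G2 H2
        has_integral_inverse_affine_abs has_integral_inverse_affine_abs_square \<open>0 < s\<close>)
  have "integral ?I G \<le> integral ?I J"
    using J pointwise by (intro integral_le) (auto simp: G_def intro!: norm_trig_poly_integrable)
  also have "\<dots> = ?v" using J by (rule integral_unique)
  \<comment> \<open>At most \<open>L\<close> coefficients of size \<open>A\<close> and at most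
    \<open>L\<close> differences of size \<open>A * s\<close> contribute equally; the negative term
    \<open>- 1 / (s + 2)\<close> is dropped.\<close>
  also have "\<dots> \<le> (s\<^sup>2 * (L * A\<^sup>2) + L * (A * s)\<^sup>2) / (A * \<kappa>) + A * \<kappa> / 2 * ((1 / s) / 2) + A * ln (1 + 2 / s)"
  proof -
    have "(\<Sum>n\<in>{a<..b}. (norm (g n))\<^sup>2) \<le> real (card {a<..b}) * A\<^sup>2"
      by (intro sum_bounded_above power_mono gA) auto
    moreover have "(\<Sum>n\<in>{a<..<b}. (norm (g (Suc n) - g n))\<^sup>2) \<le> L * (A * s)\<^sup>2"
    proof -
      have "(\<Sum>n\<in>{a<..<b}. (norm (g (Suc n) - g n))\<^sup>2) \<le> real (card {a<..<b}) * (A * s)\<^sup>2"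
        by (intro sum_bounded_above power_mono dA) auto
      also have "\<dots> \<le> L * (A * s)\<^sup>2" by (intro mult_right_mono) (auto simp: L_def)
      finally show ?thesis .
    qed
    ultimately show ?thesis using \<kappa> assms
      by (intro add_mono divide_right_mono mult_left_mono) (auto simp: L_def)
  qed
  also have "\<dots> = A * (2 * s\<^sup>2 * L / \<kappa> + \<kappa> / (4 * s)) + A * ln (1 + 2 / s)"
    using \<kappa> assms by (simp add: field_simps power2_eq_square)
  also have "2 * s\<^sup>2 * L / \<kappa> + \<kappa> / (4 * s) = sqrt (2 * s * L)"
  proof -
    have r: "sqrt (8 * s * L) = 2 * sqrt (2 * s * L)"
      using real_sqrt_mult[of 4 "2 * s * L"] by (simp add: mult.assoc)
    define q where "q = sqrt (2 * s * L)"
    have "q * q = 2 * s * L" "q > 0" using assms L by (auto simp: q_def)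
    then have "s * L = q * q / 2" by simp
    then have "2 * s\<^sup>2 * L / \<kappa> = q / 2"
      using \<open>q > 0\<close> \<open>s > 0\<close> unfolding \<kappa>_def r q_def[symmetric] by (simp add: field_simps power2_eq_square)
    moreover have "\<kappa> / (4 * s) = q / 2"
      using \<open>s > 0\<close> unfolding \<kappa>_def r q_def[symmetric] by simp
    ultimately show ?thesis by (simp add: q_def)
  qed
  finally show ?thesis by (simp add: G_def L_def distrib_left)
qed

section \<open>Growth of a cusp form towards the real axis\<close>

text \<open>Absolute convergence at height 1/10 dominates every height from 1/5 on: since
  \<open>n >= 1\<close>, moving up from 1/10 to \<open>Im z\<close> shrinks each term by at least
  \<open>exp (- 2 * pi * (Im z - 1/10))\<close>. Starting the expansion at \<open>n = 1\<close> is
  vanishing at the cusp.\<close>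

lemma fourier_series_exponential_decay:
  assumes "\<And>z. z \<in> upper_half_plane \<Longrightarrow> ((\<lambda>n::nat. a n * e2pi (of_nat n * z)) has_sum f z) {1..}"
  obtains K where "K \<ge> 0" "\<And>z. Im z \<ge> 1/5 \<Longrightarrow> norm (f z) \<le> K * exp (- (2 * pi * Im z))"
proof -
  have norm_e: "norm (e2pi (of_nat n * z)) = exp (- (2 * pi * real n * Im z))" for n z
    by (simp add: e2pi_def)
  have "((\<lambda>n. a n * e2pi (of_nat n * (\<i> / 10))) has_sum f (\<i> / 10)) {1..}"
    by (rule assms) (simp add: upper_half_plane_def)
  \<comment> \<open>\<open>has_sum\<close> means unconditional convergence, which for complex terms
    is absolute.\<close>
  then have "(\<lambda>n. norm (a n * e2pi (of_nat n * (\<i> / 10)))) summable_on {1..}"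
    unfolding summable_on_iff_abs_summable_on_complex[symmetric] by (rule has_sum_imp_summable)
  then obtain K where "((\<lambda>n. norm (a n * e2pi (of_nat n * (\<i> / 10)))) has_sum K) {1..}"
    by (auto simp: summable_on_def)
  then have K: "((\<lambda>n. norm (a n) * exp (- (2 * pi * real n / 10))) has_sum K) {1..}"
    by (simp only: norm_mult norm_e) simp
  show thesis
  proof
    show "K * exp (2 * pi / 10) \<ge> 0"
      using K has_sum_nonneg[OF K] by simp
    fix z assume z: "Im z \<ge> 1/5"
    have "norm (f z) \<le> K * exp (2 * pi / 10 - 2 * pi * Im z)"
    proof (rule norm_infsum_le)
      show "((\<lambda>n. a n * e2pi (of_nat n * z)) has_sum f z) {1..}"
        using z by (intro assms) (simp add: upper_half_plane_def)
      show "((\<lambda>n. norm (a n) * exp (- (2 * pi * real n / 10)) * exp (2 * pi / 10 - 2 * pi * Im z))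
          has_sum K * exp (2 * pi / 10 - 2 * pi * Im z)) {1..}"
        using K by (rule has_sum_cmult_left)
      fix n :: nat assume "n \<in> {1..}"
      then have "1 * (2 * pi * (Im z - 1/10)) \<le> real n * (2 * pi * (Im z - 1/10))"
        using z by (intro mult_right_mono) auto
      then have "- (2 * pi * real n * Im z) \<le> - (2 * pi * real n / 10) + (2 * pi / 10 - 2 * pi * Im z)"
        by (simp add: algebra_simps)
      then have "exp (- (2 * pi * real n * Im z)) \<le> exp (- (2 * pi * real n / 10)) * exp (2 * pi / 10 - 2 * pi * Im z)"
        by (simp only: exp_add[symmetric] exp_le_cancel_iff)
      then show "norm (a n * e2pi (of_nat n * z)) \<le> norm (a n) * exp (- (2 * pi * real n / 10)) * exp (2 * pi / 10 - 2 * pi * Im z)"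
        by (simp only: norm_mult norm_e mult.assoc) (intro mult_left_mono norm_ge_zero)
    qed
    then show "norm (f z) \<le> K * exp (2 * pi / 10) * exp (- (2 * pi * Im z))"
      by (simp only: diff_conv_add_uminus exp_add mult.assoc)
  qed
qed

text \<open>Lets the decay of \<open>f\<close> absorb the power of the height. For
  \<open>p > 0\<close> the constant \<open>p powr p\<close> comes from \<open>ln u <= u - 1\<close>
  at \<open>u = y / p\<close>; otherwise the power is non-increasing and is largest at 1/5.\<close>

lemma powr_le_exp:
  fixes p :: real
  obtains K where "K > 0" "\<And>y. y \<ge> 1/5 \<Longrightarrow> y powr p \<le> K * exp (2 * pi * y)"
proof (cases "p > 0")
  case True
  show thesis
  proof
    show "p powr p > 0" using True by simp
    fix y :: real assume y: "y \<ge> 1/5"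
    have "ln (y / p) \<le> y / p - 1" using y True by (intro ln_le_minus_one) auto
    then have "p * ln (y / p) \<le> p * (y / p - 1)" using True by (intro mult_left_mono) auto
    then have "p * ln y \<le> p * ln p + y" using y True by (simp add: ln_div algebra_simps)
    then have "y powr p \<le> p powr p * exp y"
      using y True by (simp add: powr_def exp_add[symmetric])
    also have "\<dots> \<le> p powr p * exp (2 * pi * y)"
      using y pi_gt3 by (intro mult_left_mono) auto
    finally show "y powr p \<le> p powr p * exp (2 * pi * y)" .
  qed
next
  case False
  show thesis
  proof
    show "(1/5::real) powr p > 0" by simp
    fix y :: real assume y: "y \<ge> 1/5"
    have "y powr p \<le> (1/5) powr p" using y False by (intro powr_mono2') auto
    also have "\<dots> * 1 \<le> (1/5) powr p * exp (2 * pi * y)"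
      using y by (intro mult_left_mono) auto
    finally show "y powr p \<le> (1/5) powr p * exp (2 * pi * y)" by simp
  qed
qed

text \<open>
  Dirichlet approximation of \<open>Re z\<close> with denominators up to \<open>1 / sqrt (Im z)\<close> makes \<open>|c z + d|\<^sup>2\<close> as small
  as \<open>5 Im z\<close>, so the fundamental domain is not needed.
\<close>

lemma exists_modular_transform_high:
  assumes "0 < Im z" "Im z \<le> 1"
  obtains a b c d :: int where "a * d - b * c = 1" "of_int c * z + of_int d \<noteq> 0"
    "Im ((of_int a * z + of_int b) / (of_int c * z + of_int d)) = Im z / (norm (of_int c * z + of_int d))\<^sup>2"
    "Im z / (norm (of_int c * z + of_int d))\<^sup>2 \<ge> 1/5"
proof -
  define y where "y = Im z"
  have y: "0 < y" "y \<le> 1" using assms by (auto simp: y_def)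
  \<comment> \<open>With \<open>N\<close> between \<open>1 / sqrt y\<close> and
    \<open>2 / sqrt y\<close>, the approximation error is at most \<open>sqrt y\<close> and the
    denominator \<open>q\<close> at most \<open>2 / sqrt y\<close>. So \<open>(Re w)^2 <= y\<close>
    and \<open>(Im w)^2 = (q * y)^2 <= 4 * y\<close>, whence the 5. The upper bound for
    \<open>N\<close> uses \<open>y <= 1\<close>.\<close>
  define N where "N = nat \<lceil>1 / sqrt y\<rceil>"
  have sy: "0 < sqrt y" "sqrt y \<le> 1" using y by auto
  have N1: "1 / sqrt y \<le> real N" unfolding N_def using sy by (simp add: real_nat_ceiling_ge)
  have "real N \<le> 1 / sqrt y + 1" unfolding N_def using sy
    using of_int_ceiling_le_add_one[of "1 / sqrt y"] by simp
  also have "\<dots> \<le> 1 / sqrt y + 1 / sqrt y"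
    using sy by (intro add_left_mono) simp
  also have "\<dots> = 2 / sqrt y" by simp
  finally have N2: "real N \<le> 2 / sqrt y" .
  have N0: "N > 0" using N1 sy by (intro Nat.gr0I) auto
  obtain h q where hq: "coprime h q" "0 < q" "q \<le> int N" "\<bar>of_int q * Re z - of_int h\<bar> < 1 / real N"
    using Dirichlet_approx_coprime[OF N0] by metis
  \<comment> \<open>Bezout coefficients complete the bottom row \<open>(q, -h)\<close> to a matrix
    of determinant 1 with top row \<open>(-u, -v)\<close>.\<close>
  obtain u v where uv: "u * h + v * q = 1"
    using bezout_int[of h q] hq(1) by (auto simp: coprime_iff_gcd_eq_1)
  define w where "w = of_int q * z + of_int (- h)"
  have w_re: "Re w = of_int q * Re z - of_int h" and w_im: "Im w = of_int q * y"
    by (auto simp: w_def y_def)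
  have w0: "w \<noteq> 0" using w_im hq y by (auto simp: complex_eq_iff)
  have "1 / real N \<le> sqrt y" using N1 sy N0 by (simp add: field_simps)
  then have "\<bar>Re w\<bar> \<le> sqrt y" using hq(4) w_re by simp
  then have r2: "(Re w)\<^sup>2 \<le> y" using y by (metis power2_abs real_le_rsqrt real_sqrt_abs2 sqrt_le_D abs_ge_zero power_mono real_sqrt_pow2 less_imp_le)
  have "real_of_int q \<le> 2 / sqrt y" using hq(3) N2 by linarith
  then have "(real_of_int q)\<^sup>2 \<le> (2 / sqrt y)\<^sup>2" using hq(2) by (intro power_mono) auto
  also have "\<dots> = 4 / y" using y by (simp add: power_divide)
  finally have "(Im w)\<^sup>2 \<le> 4 / y * y\<^sup>2" unfolding w_im power_mult_distrib by (intro mult_right_mono) auto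
  then have i2: "(Im w)\<^sup>2 \<le> 4 * y" using y by (simp add: power2_eq_square)
  have nw: "(norm w)\<^sup>2 \<le> 5 * y" using r2 i2 by (simp add: cmod_power2)
  show thesis
  proof
    show "(- u) * (- h) - (- v) * q = 1" using uv by simp
    then have det: "of_int (- u) * of_int (- h) - of_int (- v) * of_int q = (1 :: real)"
      by (metis of_int_1 of_int_diff of_int_mult)
    show "of_int q * z + of_int (- h) \<noteq> 0" using w0 by (simp add: w_def)
    have "Im ((of_int (- u) * z + of_int (- v)) / w) =
        (of_int (- u) * y * Re w - (of_int (- u) * Re z + of_int (- v)) * Im w) / (norm w)\<^sup>2"
      by (simp add: Im_divide cmod_power2 y_def)
    also have "of_int (- u) * y * Re w - (of_int (- u) * Re z + of_int (- v)) * Im w =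
        y * (of_int (- u) * of_int (- h) - of_int (- v) * of_int q)"
      unfolding w_re w_im by (simp add: algebra_simps)
    finally show "Im ((of_int (- u) * z + of_int (- v)) / (of_int q * z + of_int (- h))) =
        Im z / (norm (of_int q * z + of_int (- h)))\<^sup>2"
      unfolding det by (simp add: w_def y_def)
    have "y / (norm w)\<^sup>2 \<ge> y / (5 * y)" using nw w0 y by (intro divide_left_mono) auto
    then show "Im z / (norm (of_int q * z + of_int (- h)))\<^sup>2 \<ge> 1/5"
      using y by (simp add: w_def y_def)
  qed
qed

text \<open>Hecke's bound: the invariant \<open>Im(z)^(k/2) |f(z)|\<close> is computed at an image
  of \<open>z\<close> of height at least 1/5, where exponential decay beats the power of the
  height.\<close>

lemma cusp_form_bound:
  assumes modular: "\<And>a b c d z. a * d - b * c = 1 \<Longrightarrow> z \<in> upper_half_plane \<Longrightarrow>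
      f ((of_int a * z + of_int b) / (of_int c * z + of_int d)) = (of_int c * z + of_int d) powi k * f z"
    and fourier: "\<And>z. z \<in> upper_half_plane \<Longrightarrow> ((\<lambda>n::nat. a n * e2pi (of_nat n * z)) has_sum f z) {1..}"
  obtains C where "C > 0"
    "\<And>z. 0 < Im z \<Longrightarrow> Im z \<le> 1 \<Longrightarrow> norm (f z) \<le> C * Im z powr (- real_of_int k / 2)"
proof -
  obtain K where K: "K \<ge> 0" "\<And>z. Im z \<ge> 1/5 \<Longrightarrow> norm (f z) \<le> K * exp (- (2 * pi * Im z))"
    using fourier_series_exponential_decay[OF fourier] by blast
  obtain L where L: "L > 0" "\<And>y. y \<ge> 1/5 \<Longrightarrow> y powr (real_of_int k / 2) \<le> L * exp (2 * pi * y)"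
    using powr_le_exp[of "real_of_int k / 2"] by blast
  show thesis
  proof
    \<comment> \<open>\<open>K\<close> may be 0; adding 1 keeps the constant positive, since it
      later serves as a truncation tolerance.\<close>
    show "L * (K + 1) > 0" using K L by simp
    fix z assume z: "0 < Im z" "Im z \<le> 1"
    obtain a b c d :: int where det: "a * d - b * c = 1"
      and w0: "of_int c * z + of_int d \<noteq> 0"
      and Im: "Im ((of_int a * z + of_int b) / (of_int c * z + of_int d)) = Im z / (norm (of_int c * z + of_int d))\<^sup>2"
      and high: "Im z / (norm (of_int c * z + of_int d))\<^sup>2 \<ge> 1/5"
      using exists_modular_transform_high[OF z] by metis
    define r where "r = norm (of_int c * z + of_int d)"
    define w where "w = (of_int a * z + of_int b) / (of_int c * z + of_int d)"
    define y where "y = Im z"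
    define Y where "Y = y / r\<^sup>2"
    have r: "r > 0" using w0 by (simp add: r_def)
    have y: "y > 0" using z by (simp add: y_def)
    have Y: "Im w = Y" "Y \<ge> 1/5" using Im high by (simp_all add: w_def Y_def y_def r_def)
    have "norm (f w) = r powi k * norm (f z)"
      using modular[OF det, of z] z
      by (simp add: w_def upper_half_plane_def norm_mult norm_power_int r_def)
    also have "r powi k = r powr real_of_int k" using r by (simp add: powr_real_of_int')
    finally have fw: "norm (f w) = r powr real_of_int k * norm (f z)" .
    have "Y powr (real_of_int k / 2) = y powr (real_of_int k / 2) / (r\<^sup>2) powr (real_of_int k / 2)"
      unfolding Y_def using y by (intro powr_divide)
    also have "(r\<^sup>2) powr (real_of_int k / 2) = r powr real_of_int k"
      using r by (simp add: powr_powr flip: powr_numeral)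
    \<comment> \<open>The automorphy factor \<open>r^k\<close> cancels against the change of height
      \<open>Y = y / r^2\<close>.\<close>
    finally have "y powr (real_of_int k / 2) * norm (f z) = Y powr (real_of_int k / 2) * norm (f w)"
      using r by (simp add: fw)
    also have "\<dots> \<le> (L * exp (2 * pi * Y)) * (K * exp (- (2 * pi * Y)))"
      using L K Y by (intro mult_mono) auto
    also have "\<dots> = L * K" by (simp add: exp_minus)
    also have "\<dots> \<le> L * (K + 1)" using L by simp
    finally show "norm (f z) \<le> L * (K + 1) * Im z powr (- real_of_int k / 2)"
      using y by (simp add: y_def powr_minus field_simps)
  qed
qed

section \<open>The exponential sum over one dyadic block\<close>

text \<open>Convergence at \<open>x = 0\<close> is absolute convergence of the coefficients, so some
  finite set leaves a tail of at most \<open>B\<close> for all \<open>x\<close> at once, and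
  enlarging it by \<open>S\<close> only shrinks the tail. The convolution argument can then work
  with finite sums.\<close>

lemma trig_series_truncation:
  fixes c :: "nat \<Rightarrow> complex" and F :: "real \<Rightarrow> complex"
  assumes F: "\<And>x. ((\<lambda>n. c n * cis (2 * pi * (real n * x))) has_sum F x) A"
    and B: "\<And>x. norm (F x) \<le> B" "0 < B"
    and S: "finite S" "S \<subseteq> A"
  obtains P where "finite P" "S \<subseteq> P"
    "\<And>x. norm (\<Sum>n\<in>P. c n * cis (2 * pi * (real n * x))) \<le> 2 * B"
proof -
  have "(\<lambda>n. norm (c n * cis (2 * pi * (real n * 0)))) summable_on A"
    unfolding summable_on_iff_abs_summable_on_complex[symmetric] by (rule has_sum_imp_summable[OF F])
  then obtain T where "((\<lambda>n. norm (c n * cis (2 * pi * (real n * 0)))) has_sum T) A"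
    by (auto simp: summable_on_def)
  then have T: "((\<lambda>n. norm (c n)) has_sum T) A" by (simp add: norm_mult)
  obtain X where X: "finite X" "X \<subseteq> A" "dist (\<Sum>n\<in>X. norm (c n)) T \<le> B"
    using has_sum_finite_approximation[OF T B(2)] by blast
  show thesis
  proof
    show "finite (X \<union> S)" "S \<subseteq> X \<union> S" using X S by auto
    fix x
    let ?P = "X \<union> S"
    have "norm (F x - (\<Sum>n\<in>?P. c n * cis (2 * pi * (real n * x)))) \<le> T - (\<Sum>n\<in>?P. norm (c n))"
    proof (rule norm_infsum_le)
      show "((\<lambda>n. c n * cis (2 * pi * (real n * x))) has_sum F x - (\<Sum>n\<in>?P. c n * cis (2 * pi * (real n * x)))) (A - ?P)"
        using X S by (intro has_sum_Diff F has_sum_finite) auto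
      show "((\<lambda>n. norm (c n)) has_sum T - (\<Sum>n\<in>?P. norm (c n))) (A - ?P)"
        using X S by (intro has_sum_Diff T has_sum_finite) auto
    qed (simp add: norm_mult)
    also have "\<dots> \<le> T - (\<Sum>n\<in>X. norm (c n))"
      using X S by (intro diff_left_mono sum_mono2) auto
    also have "\<dots> \<le> B" using X by (simp add: dist_real_def)
    finally have "norm ((\<Sum>n\<in>?P. c n * cis (2 * pi * (real n * x))) - F x) \<le> B"
      by (simp only: norm_minus_commute)
    with B(1)[of x] show "norm (\<Sum>n\<in>?P. c n * cis (2 * pi * (real n * x))) \<le> 2 * B"
      using norm_triangle_ineq2[of "\<Sum>n\<in>?P. c n * cis (2 * pi * (real n * x))" "F x"] by linarith
  qed
qed

lemma powr_comparable_bound: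
  fixes M t p :: real
  assumes "0 < M" "M / 2 \<le> t" "t \<le> M"
  shows "t powr p \<le> 2 powr \<bar>p\<bar> * M powr p"
proof (cases "p \<ge> 0")
  case True
  then have "t powr p \<le> 1 * M powr p" using assms by (simp add: powr_mono2)
  also have "\<dots> \<le> 2 powr \<bar>p\<bar> * M powr p"
    by (intro mult_right_mono ge_one_powr_ge_zero) auto
  finally show ?thesis .
next
  case False
  then have "t powr p \<le> (M / 2) powr p" using assms by (intro powr_mono2') auto
  also have "\<dots> = 2 powr \<bar>p\<bar> * M powr p" using False assms by (simp add: powr_divide powr_minus field_simps)
  finally show ?thesis .
qed

text \<open>The weight undoes the normalisation \<open>n^\<kappa>\<close> and the damping
  \<open>exp (- 2 * pi * n / M)\<close> of \<open>f\<close> at height \<open>1 / M\<close>, and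
  inserts the phase \<open>\<beta> * n^\<theta>\<close>. Its logarithmic derivative is
  \<open>O(M^(\<theta> - 1))\<close> on the block, which controls the increments. The equation for
  \<open>g\<close> is a premise so that a local definition can be plugged in.\<close>

lemma oscillating_weight_bounds:
  fixes \<kappa> \<theta> \<beta> :: real
  assumes \<theta>: "0 \<le> \<theta>" "\<theta> < 1"
  obtains K where "K > 0"
    "\<And>M n g. M \<ge> 1 \<Longrightarrow> g = (\<lambda>t. of_real (t powr (- \<kappa>) * exp (2 * pi * t / real M)) * cis (2 * pi * (\<beta> * t powr \<theta>))) \<Longrightarrow>
       M div 2 < n \<Longrightarrow> n \<le> M \<Longrightarrow> norm (g (real n)) \<le> K * real M powr (- \<kappa>)"
    "\<And>M n g. M \<ge> 1 \<Longrightarrow> g = (\<lambda>t. of_real (t powr (- \<kappa>) * exp (2 * pi * t / real M)) * cis (2 * pi * (\<beta> * t powr \<theta>))) \<Longrightarrow>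
       M div 2 < n \<Longrightarrow> n < M \<Longrightarrow>
       norm (g (real (Suc n)) - g (real n)) \<le> K * real M powr (- \<kappa>) * real M powr (\<theta> - 1)"
proof -
  \<comment> \<open>\<open>K1\<close> bounds the power and the exponential on the block. The
    summands of \<open>K2\<close> bound the logarithmic derivatives of the power, the exponential
    and the phase, in this order.\<close>
  define K1 where "K1 = 2 powr \<bar>\<kappa>\<bar> * exp (2 * pi)"
  define K2 where "K2 = 2 * \<bar>\<kappa>\<bar> + 2 * pi + 4 * pi * \<bar>\<beta>\<bar>"
  have K1: "K1 > 0" by (simp add: K1_def)
  have K2: "K2 \<ge> 0" by (simp add: K2_def)
  define g where "g = (\<lambda>M t. of_real (t powr (- \<kappa>) * exp (2 * pi * t / real M)) * cis (2 * pi * (\<beta> * t powr \<theta>)))"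
  have size: "norm (g M t) \<le> K1 * real M powr (- \<kappa>)" if "M \<ge> 1" "real M / 2 \<le> t" "t \<le> real M" for M t
  proof -
    have "norm (g M t) = t powr (- \<kappa>) * exp (2 * pi * t / real M)"
      by (simp add: g_def norm_mult)
    also have "\<dots> \<le> (2 powr \<bar>- \<kappa>\<bar> * real M powr (- \<kappa>)) * exp (2 * pi)"
      using that by (intro mult_mono powr_comparable_bound) (auto simp: field_simps)
    finally show ?thesis by (simp add: K1_def mult_ac)
  qed
  have deriv: "(g M has_vector_derivative (of_real (- \<kappa> / t + 2 * pi / real M) + \<i> * of_real (2 * pi * \<beta> * (\<theta> * t powr (\<theta> - 1)))) * g M t)
      (at t within X)" if "M \<ge> 1" "t > 0" for M t X
  proof -
    let ?\<phi> = "\<lambda>t. of_real (- \<kappa> * ln t + 2 * pi * t / real M) + \<i> * of_real (2 * pi * (\<beta> * t powr \<theta>)) :: complex"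
    have g_exp: "g M t = exp (?\<phi> t)" if "t > 0" for t
    proof -
      have "t powr (- \<kappa>) * exp (2 * pi * t / real M) = exp (- \<kappa> * ln t + 2 * pi * t / real M)"
        using that by (simp add: powr_def exp_diff exp_minus exp_add field_simps)
      then show ?thesis
        unfolding g_def by (simp only: exp_of_real exp_add cis_conv_exp)
    qed
    have "(?\<phi> has_vector_derivative of_real (- \<kappa> / t + 2 * pi / real M) + \<i> * of_real (2 * pi * \<beta> * (\<theta> * t powr (\<theta> - 1)))) (at t)"
      using that
      by (intro has_vector_derivative_add has_vector_derivative_of_real has_vector_derivative_mult_right)
        (auto intro!: derivative_eq_intros simp: field_simps simp flip: has_real_derivative_iff_has_vector_derivative)
    from field_vector_diff_chain_at[OF this DERIV_exp]
    have "((\<lambda>t. exp (?\<phi> t)) has_vector_derivative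
        (of_real (- \<kappa> / t + 2 * pi / real M) + \<i> * of_real (2 * pi * \<beta> * (\<theta> * t powr (\<theta> - 1)))) * exp (?\<phi> t)) (at t)"
      by (simp add: o_def)
    then have "(g M has_vector_derivative
        (of_real (- \<kappa> / t + 2 * pi / real M) + \<i> * of_real (2 * pi * \<beta> * (\<theta> * t powr (\<theta> - 1)))) * exp (?\<phi> t)) (at t)"
      by (rule has_vector_derivative_transform_within_open[of _ _ _ "{0<..}"]) (use that g_exp in auto)
    then show ?thesis using g_exp that by (simp add: has_vector_derivative_at_within)
  qed
  have slope: "norm (of_real (- \<kappa> / t + 2 * pi / real M) + \<i> * of_real (2 * pi * \<beta> * (\<theta> * t powr (\<theta> - 1))) :: complex)
      \<le> K2 * real M powr (\<theta> - 1)" if M: "M \<ge> 1" "real M / 2 \<le> t" "t \<le> real M" for M t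
  proof -
    have t: "t > 0" using M by simp
    \<comment> \<open>Here \<open>\<theta> >= 0\<close> enters: the non-oscillating factors vary no
      faster than the bound allowed for the phase.\<close>
    have inv_M: "1 / real M \<le> real M powr (\<theta> - 1)"
      using M powr_mono[of "-1" "\<theta> - 1" "real M"] \<theta> by (simp add: powr_minus field_simps)
    have "\<bar>\<kappa>\<bar> / t \<le> 2 * \<bar>\<kappa>\<bar> * (1 / real M)"
      using M t divide_left_mono[of "real M / 2" t "\<bar>\<kappa>\<bar>"] by (simp add: mult.commute)
    also have "\<dots> \<le> 2 * \<bar>\<kappa>\<bar> * real M powr (\<theta> - 1)" by (intro mult_left_mono inv_M) auto
    finally have 1: "\<bar>\<kappa>\<bar> / t \<le> 2 * \<bar>\<kappa>\<bar> * real M powr (\<theta> - 1)" .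
    have 2: "2 * pi / real M \<le> 2 * pi * real M powr (\<theta> - 1)"
      using mult_left_mono[OF inv_M, of "2 * pi"] by simp
    have "t powr (\<theta> - 1) \<le> 2 powr \<bar>\<theta> - 1\<bar> * real M powr (\<theta> - 1)"
      using M by (intro powr_comparable_bound) auto
    also have "\<dots> \<le> 2 powr 1 * real M powr (\<theta> - 1)"
      using \<theta> by (intro mult_right_mono powr_mono) auto
    finally have "\<theta> * t powr (\<theta> - 1) \<le> 1 * (2 * real M powr (\<theta> - 1))"
      using \<theta> by (intro mult_mono) auto
    then have "2 * pi * \<bar>\<beta>\<bar> * (\<theta> * t powr (\<theta> - 1)) \<le> 2 * pi * \<bar>\<beta>\<bar> * (2 * real M powr (\<theta> - 1))"
      by (intro mult_left_mono) auto
    then have 3: "2 * pi * \<bar>\<beta>\<bar> * (\<theta> * t powr (\<theta> - 1)) \<le> 4 * pi * \<bar>\<beta>\<bar> * real M powr (\<theta> - 1)"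
      by simp
    have "norm (of_real (- \<kappa> / t + 2 * pi / real M) + \<i> * of_real (2 * pi * \<beta> * (\<theta> * t powr (\<theta> - 1))) :: complex)
        \<le> \<bar>- \<kappa> / t + 2 * pi / real M\<bar> + \<bar>2 * pi * \<beta> * (\<theta> * t powr (\<theta> - 1))\<bar>"
      by (rule order.trans[OF norm_triangle_ineq]) (simp only: norm_mult norm_of_real norm_ii mult_1_left order_refl)
    also have "\<bar>2 * pi * \<beta> * (\<theta> * t powr (\<theta> - 1))\<bar> = 2 * pi * \<bar>\<beta>\<bar> * (\<theta> * t powr (\<theta> - 1))"
      using \<theta> by (simp add: abs_mult)
    also have "\<bar>- \<kappa> / t + 2 * pi / real M\<bar> \<le> \<bar>\<kappa>\<bar> / t + 2 * pi / real M"
      by (rule order.trans[OF abs_triangle_ineq]) (use t in simp)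
    also have "\<bar>\<kappa>\<bar> / t + 2 * pi / real M + 2 * pi * \<bar>\<beta>\<bar> * (\<theta> * t powr (\<theta> - 1)) \<le> K2 * real M powr (\<theta> - 1)"
      unfolding K2_def distrib_right using 1 2 3 by linarith
    finally show ?thesis by simp
  qed
  have step: "norm (g M (real (Suc n)) - g M (real n)) \<le> K1 * K2 * real M powr (- \<kappa>) * real M powr (\<theta> - 1)"
    if n: "M div 2 < n" "n < M" for M n
  proof -
    have M: "M \<ge> 1" "real M / 2 \<le> real n" "real (Suc n) \<le> real M" using n by linarith+
    \<comment> \<open>Mean value inequality on \<open>[n, n + 1]\<close>, which lies inside
      \<open>[M/2, M]\<close>, where \<open>size\<close> and \<open>slope\<close> both hold.\<close>
    have "norm (g M (real (Suc n)) - g M (real n)) \<le>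
        (K2 * real M powr (\<theta> - 1)) * (K1 * real M powr (- \<kappa>)) * norm (real (Suc n) - real n)"
    proof (rule differentiable_bound[where S = "{real n..real (Suc n)}"])
      fix t assume "t \<in> {real n..real (Suc n)}"
      then have t: "real M / 2 \<le> t" "t \<le> real M" "t > 0" using M by auto
      let ?D = "(of_real (- \<kappa> / t + 2 * pi / real M) + \<i> * of_real (2 * pi * \<beta> * (\<theta> * t powr (\<theta> - 1)))) * g M t"
      show "(g M has_derivative (\<lambda>h. h *\<^sub>R ?D)) (at t within {real n..real (Suc n)})"
        using deriv[OF M(1) t(3)] by (simp only: has_vector_derivative_def)
      have D: "norm ((of_real (- \<kappa> / t + 2 * pi / real M) + \<i> * of_real (2 * pi * \<beta> * (\<theta> * t powr (\<theta> - 1)))) * g M t)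
          \<le> (K2 * real M powr (\<theta> - 1)) * (K1 * real M powr (- \<kappa>))"
        unfolding norm_mult using K2 by (intro mult_mono slope size M t) auto
      show "onorm (\<lambda>h. h *\<^sub>R ?D) \<le> (K2 * real M powr (\<theta> - 1)) * (K1 * real M powr (- \<kappa>))"
      proof (rule onorm_bound)
        show "0 \<le> (K2 * real M powr (\<theta> - 1)) * (K1 * real M powr (- \<kappa>))" using K1 K2 by simp
        show "norm (h *\<^sub>R ?D) \<le> (K2 * real M powr (\<theta> - 1)) * (K1 * real M powr (- \<kappa>)) * norm h" for h :: real
          using mult_right_mono[OF D norm_ge_zero[of h]] by (simp only: norm_scaleR real_norm_def mult.commute)
      qed
    qed auto
    then show ?thesis by (simp add: mult_ac)
  qed
  show thesis
  proof (rule that[of "K1 * (1 + K2)"])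
    show "K1 * (1 + K2) > 0" using K1 K2 by simp
    fix M n :: nat and h :: "real \<Rightarrow> complex"
    assume M: "M \<ge> 1" and n: "M div 2 < n"
      and h: "h = (\<lambda>t. of_real (t powr (- \<kappa>) * exp (2 * pi * t / real M)) * cis (2 * pi * (\<beta> * t powr \<theta>)))"
    have h: "h = g M" unfolding h g_def ..
    {
      assume "n \<le> M"
      then have "norm (h (real n)) \<le> K1 * real M powr (- \<kappa>)"
        unfolding h using M n by (intro size) linarith+
      also have "\<dots> \<le> K1 * (1 + K2) * real M powr (- \<kappa>)"
        using K1 K2 by (intro mult_right_mono) (auto simp: algebra_simps)
      finally show "norm (h (real n)) \<le> K1 * (1 + K2) * real M powr (- \<kappa>)" .
    }
    {
      assume "n < M"
      then have "norm (h (real (Suc n)) - h (real n)) \<le> K1 * K2 * real M powr (- \<kappa>) * real M powr (\<theta> - 1)"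
        unfolding h using n by (intro step)
      also have "\<dots> \<le> K1 * (1 + K2) * real M powr (- \<kappa>) * real M powr (\<theta> - 1)"
        using K1 K2 by (intro mult_right_mono) (auto simp: algebra_simps)
      finally show "norm (h (real (Suc n)) - h (real n)) \<le> K1 * (1 + K2) * real M powr (- \<kappa>) * real M powr (\<theta> - 1)" .
    }
  qed
qed

text \<open>At height \<open>1 / M\<close> the form contributes \<open>M^(k/2)\<close> and the
  weight \<open>M^(-(k-1)/2)\<close>, so \<open>k\<close> cancels and \<open>M^(1/2)\<close>
  remains. The bracket is the L1 estimate with \<open>s = M^(\<theta> - 1)\<close> and at most
  \<open>M\<close> terms.\<close>

lemma dyadic_block_bound:
  fixes f :: "complex \<Rightarrow> complex" and lam :: "nat \<Rightarrow> complex" and k \<theta> \<beta> C :: real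
  assumes C: "C > 0" "\<And>z. 0 < Im z \<Longrightarrow> Im z \<le> 1 \<Longrightarrow> norm (f z) \<le> C * Im z powr (- k / 2)"
    and fourier: "\<And>z. z \<in> upper_half_plane \<Longrightarrow>
           ((\<lambda>n. lam n * of_real (real n powr ((k - 1) / 2)) * e2pi (of_nat n * z)) has_sum f z) {1..}"
    and \<theta>: "0 \<le> \<theta>" "\<theta> < 1"
  obtains D where "D > 0"
    "\<And>M \<alpha>. M \<ge> 1 \<Longrightarrow> norm (\<Sum>n\<in>{M div 2<..M}. lam n * cis (2 * pi * (\<beta> * real n powr \<theta> + \<alpha> * real n)))
      \<le> D * (real M powr (1/2) * (sqrt (2 * real M powr \<theta>) + ln (1 + 2 * real M powr (1 - \<theta>))))"
proof -
  define \<kappa> where "\<kappa> = (k - 1) / 2"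
  obtain K where K: "K > 0"
    "\<And>M n g. M \<ge> 1 \<Longrightarrow> g = (\<lambda>t. of_real (t powr (- \<kappa>) * exp (2 * pi * t / real M)) * cis (2 * pi * (\<beta> * t powr \<theta>))) \<Longrightarrow>
       M div 2 < n \<Longrightarrow> n \<le> M \<Longrightarrow> norm (g (real n)) \<le> K * real M powr (- \<kappa>)"
    "\<And>M n g. M \<ge> 1 \<Longrightarrow> g = (\<lambda>t. of_real (t powr (- \<kappa>) * exp (2 * pi * t / real M)) * cis (2 * pi * (\<beta> * t powr \<theta>))) \<Longrightarrow>
       M div 2 < n \<Longrightarrow> n < M \<Longrightarrow>
       norm (g (real (Suc n)) - g (real n)) \<le> K * real M powr (- \<kappa>) * real M powr (\<theta> - 1)"
    using oscillating_weight_bounds[OF \<theta>, of \<kappa> \<beta>] by metis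
  show thesis
  proof (rule that[of "2 * C * K"])
    show "2 * C * K > 0" using C K by simp
    fix M :: nat and \<alpha> :: real
    assume M: "M \<ge> 1"
    \<comment> \<open>\<open>c n\<close> is the Fourier coefficient of \<open>f\<close> along the
      line of height \<open>1 / M\<close>; multiplying by \<open>g n\<close> leaves
      \<open>lam n\<close> times the phase in \<open>\<beta>\<close>.\<close>
    define g where "g = (\<lambda>t. of_real (t powr (- \<kappa>) * exp (2 * pi * t / real M)) * cis (2 * pi * (\<beta> * t powr \<theta>)))"
    define c where "c = (\<lambda>n. lam n * of_real (real n powr \<kappa> * exp (- (2 * pi * real n / real M))))"
    define F where "F = (\<lambda>x. f (Complex x (1 / real M)))"
    define S where "S = {M div 2<..M}"
    define s where "s = real M powr (\<theta> - 1)"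
    define A where "A = K * real M powr (- \<kappa>)"
    define B where "B = C * real M powr (k / 2)"
    have e: "e2pi (of_nat n * Complex x (1 / real M)) = of_real (exp (- (2 * pi * real n / real M))) * cis (2 * pi * (real n * x))" for n x
    proof -
      have "2 * of_real pi * \<i> * (of_nat n * Complex x (1 / real M)) = of_real (- (2 * pi * real n / real M)) + \<i> * of_real (2 * pi * (real n * x))"
        by (simp add: complex_eq_iff)
      then show ?thesis unfolding e2pi_def by (simp only: exp_add exp_of_real cis_conv_exp)
    qed
    have F: "((\<lambda>n. c n * cis (2 * pi * (real n * x))) has_sum F x) {1..}" for x
      using fourier[of "Complex x (1 / real M)"] M
      by (simp add: upper_half_plane_def e c_def F_def \<kappa>_def mult.assoc)
    have B: "norm (F x) \<le> B" "B > 0" for x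
      using C(1) C(2)[of "Complex x (1 / real M)"] M
      by (simp_all add: F_def B_def powr_divide powr_minus)
    have S: "finite S" "S \<subseteq> {1..}" by (auto simp: S_def)
    obtain P where P: "finite P" "S \<subseteq> P" "\<And>x. norm (\<Sum>n\<in>P. c n * cis (2 * pi * (real n * x))) \<le> 2 * B"
      using trig_series_truncation[OF F B S] by metis
    have cg: "c n * g (real n) * cis (2 * pi * (real n * \<alpha>)) = lam n * cis (2 * pi * (\<beta> * real n powr \<theta> + \<alpha> * real n))"
      if "n \<in> S" for n
    proof -
      have n: "real n > 0" using that by (auto simp: S_def)
      have "real n powr \<kappa> * exp (- (2 * pi * real n / real M)) * (real n powr (- \<kappa>) * exp (2 * pi * real n / real M)) = 1"
        using n by (simp add: powr_minus exp_minus field_simps)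
      then have one: "complex_of_real (real n powr \<kappa> * exp (- (2 * pi * real n / real M))) *
          of_real (real n powr (- \<kappa>) * exp (2 * pi * real n / real M)) = 1"
        by (simp only: of_real_mult[symmetric] of_real_1)
      have "c n * g (real n) * cis (2 * pi * (real n * \<alpha>)) =
          (complex_of_real (real n powr \<kappa> * exp (- (2 * pi * real n / real M))) *
          of_real (real n powr (- \<kappa>) * exp (2 * pi * real n / real M))) *
          (lam n * (cis (2 * pi * (\<beta> * real n powr \<theta>)) * cis (2 * pi * (real n * \<alpha>))))"
        unfolding c_def g_def by (simp only: mult_ac)
      then show ?thesis unfolding one by (simp add: cis_mult algebra_simps)
    qed
    have L1: "integral {-1/2..1/2} (\<lambda>x. norm (\<Sum>n\<in>S. g (real n) * cis (2 * pi * (real n * x))))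
        \<le> A * (sqrt (2 * s * real (M - M div 2)) + ln (1 + 2 / s))"
      unfolding S_def A_def s_def
      by (intro trig_poly_L1_bound K(2)[OF M g_def] K(3)[OF M g_def]) (use M K(1) in auto)
    have "norm (\<Sum>n\<in>S. lam n * cis (2 * pi * (\<beta> * real n powr \<theta> + \<alpha> * real n))) =
        norm (\<Sum>n\<in>S. c n * g (real n) * cis (2 * pi * (real n * \<alpha>)))"
      using cg by simp
    \<comment> \<open>The twist by \<alpha> is the evaluation point of the convolution, so it
      disappears from the bound here.\<close>
    also have "\<dots> \<le> 2 * B * integral {-1/2..1/2} (\<lambda>x. norm (\<Sum>n\<in>S. g (real n) * cis (2 * pi * (real n * x))))"
      by (rule coefficient_twist_bound[OF P])
    also have "\<dots> \<le> 2 * B * (A * (sqrt (2 * real M powr \<theta>) + ln (1 + 2 * real M powr (1 - \<theta>))))"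
    proof -
      have "s * real (M - M div 2) \<le> s * real M" unfolding s_def by (intro mult_left_mono) auto
      also have "\<dots> = real M powr (\<theta> - 1) * real M powr 1" using M by (simp add: s_def)
      also have "\<dots> = real M powr \<theta>" by (simp only: powr_add[symmetric]) simp
      finally have "sqrt (2 * s * real (M - M div 2)) \<le> sqrt (2 * real M powr \<theta>)" by simp
      moreover have "2 / s = 2 * real M powr (1 - \<theta>)"
        using powr_minus_divide[of "real M" "1 - \<theta>"] by (simp add: s_def)
      ultimately have "sqrt (2 * s * real (M - M div 2)) + ln (1 + 2 / s)
          \<le> sqrt (2 * real M powr \<theta>) + ln (1 + 2 * real M powr (1 - \<theta>))" by simp
      then have "A * (sqrt (2 * s * real (M - M div 2)) + ln (1 + 2 / s))
          \<le> A * (sqrt (2 * real M powr \<theta>) + ln (1 + 2 * real M powr (1 - \<theta>)))"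
        using K(1) by (intro mult_left_mono) (auto simp: A_def)
      with L1 show ?thesis using B(2) by (intro mult_left_mono) linarith+
    qed
    also have "\<dots> = 2 * C * K * ((real M powr (k / 2) * real M powr (- \<kappa>)) * (sqrt (2 * real M powr \<theta>) + ln (1 + 2 * real M powr (1 - \<theta>))))"
      by (simp add: A_def B_def mult_ac)
    also have "real M powr (k / 2) * real M powr (- \<kappa>) = real M powr (1/2)"
      by (simp only: powr_add[symmetric]) (simp add: \<kappa>_def field_simps)
    finally show "norm (\<Sum>n\<in>{M div 2<..M}. lam n * cis (2 * pi * (\<beta> * real n powr \<theta> + \<alpha> * real n)))
      \<le> 2 * C * K * (real M powr (1/2) * (sqrt (2 * real M powr \<theta>) + ln (1 + 2 * real M powr (1 - \<theta>))))"
      by (simp only: S_def)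
  qed
qed

section \<open>Summation over dyadic blocks\<close>

text \<open>The logarithm is absorbed through \<open>ln x <= x powr \<epsilon> / \<epsilon>\<close>.
  The 4 is made up of \<open>sqrt 2 <= 2\<close> and \<open>ln 3 <= 2\<close>.\<close>

lemma sqrt_add_ln_le_powr:
  fixes x \<theta> \<epsilon> :: real
  assumes "x \<ge> 1" "0 \<le> \<theta>" "\<epsilon> > 0"
  shows "sqrt (2 * x powr \<theta>) + ln (1 + 2 * x powr (1 - \<theta>)) \<le> (4 + 1 / \<epsilon>) * x powr (\<theta> / 2 + \<epsilon>)"
proof -
  define y where "y = x powr (\<theta> / 2 + \<epsilon>)"
  have y1: "y \<ge> 1" unfolding y_def using assms by (intro ge_one_powr_ge_zero) auto
  have "sqrt (2 * x powr \<theta>) = sqrt 2 * x powr (\<theta> / 2)"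
    using assms by (simp add: real_sqrt_mult powr_half_sqrt[symmetric] powr_powr)
  also have "\<dots> \<le> 2 * y"
    unfolding y_def using assms by (intro mult_mono powr_mono) (auto intro: real_le_lsqrt)
  finally have 1: "sqrt (2 * x powr \<theta>) \<le> 2 * y" .
  have "x powr (1 - \<theta>) \<le> x powr 1" using assms by (intro powr_mono) auto
  then have "1 + 2 * x powr (1 - \<theta>) \<le> 3 * x" using assms by simp
  moreover have "1 + 2 * x powr (1 - \<theta>) > 0" by (intro add_pos_nonneg) auto
  ultimately have "ln (1 + 2 * x powr (1 - \<theta>)) \<le> ln (3 * x)" by simp
  also have "\<dots> = ln 3 + ln x" using assms by (simp add: ln_mult)
  also have "ln 3 \<le> (2::real)" using ln_le_minus_one[of 3] by simp
  also have "ln x \<le> x powr \<epsilon> / \<epsilon>" using assms by (intro ln_powr_bound)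
  also have "x powr \<epsilon> / \<epsilon> \<le> y / \<epsilon>"
    unfolding y_def using assms by (intro divide_right_mono powr_mono) auto
  finally have "ln (1 + 2 * x powr (1 - \<theta>)) \<le> 2 * y + y / \<epsilon>" using y1 by linarith
  with 1 show ?thesis by (simp add: y_def algebra_simps)
qed

text \<open>Induction by halving \<open>M\<close>: since \<open>\<sigma> >= 1/2\<close>, the half
  range carries a factor \<open>2^(-\<sigma>) <= 3/4\<close>, and the constant 4 reproduces itself
  because \<open>4 * 3/4 + 1 = 4\<close>.\<close>

lemma sum_bound_from_dyadic_blocks:
  fixes u :: "nat \<Rightarrow> 'a :: real_normed_vector" and D \<sigma> :: real
  assumes D: "D \<ge> 0" and \<sigma>: "\<sigma> \<ge> 1/2"
    and block: "\<And>M. M \<ge> 1 \<Longrightarrow> norm (\<Sum>n\<in>{M div 2<..M}. u n) \<le> D * real M powr \<sigma>"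
  shows "norm (\<Sum>n\<in>{1..M}. u n) \<le> 4 * D * real M powr \<sigma>"
proof (induction M rule: less_induct)
  case (less M)
  show ?case
  proof (cases "M = 0")
    case False
    have "(1/2 :: real) powr \<sigma> \<le> (1/2) powr (1/2)" using \<sigma> by (intro powr_mono') auto
    also have "\<dots> = sqrt (1/2)" by (rule powr_half_sqrt) simp
    also have "\<dots> \<le> 3/4" by (rule real_le_lsqrt) (auto simp: power2_eq_square)
    finally have half: "(1/2 :: real) powr \<sigma> \<le> 3/4" .
    have "real (M div 2) \<le> 1/2 * real M" by linarith
    then have "real (M div 2) powr \<sigma> \<le> (1/2 * real M) powr \<sigma>" using \<sigma> by (intro powr_mono2) auto
    also have "\<dots> = (1/2) powr \<sigma> * real M powr \<sigma>" by (intro powr_mult)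
    also have "\<dots> \<le> 3/4 * real M powr \<sigma>" using half by (intro mult_right_mono) auto
    finally have pow: "real (M div 2) powr \<sigma> \<le> 3/4 * real M powr \<sigma>" .
    have split: "{1..M} = {1..M div 2} \<union> {M div 2<..M}" "{1..M div 2} \<inter> {M div 2<..M} = {}" by auto
    have "norm (\<Sum>n\<in>{1..M}. u n) \<le> norm (\<Sum>n\<in>{1..M div 2}. u n) + norm (\<Sum>n\<in>{M div 2<..M}. u n)"
      unfolding split(1) using split(2) by (subst sum.union_disjoint) (auto intro: norm_triangle_ineq)
    also have "\<dots> \<le> 4 * D * real (M div 2) powr \<sigma> + D * real M powr \<sigma>"
      using False by (intro add_mono less.IH block) auto
    also have "\<dots> \<le> 4 * D * (3/4 * real M powr \<sigma>) + D * real M powr \<sigma>"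
      using D by (intro add_right_mono mult_left_mono pow) auto
    finally show ?thesis by simp
  qed simp
qed

theorem theorem1p4:
  fixes f :: "complex \<Rightarrow> complex" and k :: int and lam :: "nat \<Rightarrow> complex"
    and \<theta> \<epsilon> \<beta> :: real
  assumes "hecke_eigenform k f"
    and "\<And>z. z \<in> upper_half_plane \<Longrightarrow>
           ((\<lambda>n. lam n * of_real (real n powr ((real_of_int k - 1) / 2)) * e2pi (of_nat n * z))
              has_sum f z) {1..}"
    and "lam 1 = 1"
    and "0 \<le> \<theta>" "\<theta> < 1" "\<epsilon> > 0"
  shows "\<exists>C. \<forall>\<^sub>F N :: real in at_top. \<forall>\<alpha> :: real.
           norm (\<Sum>n\<in>{1..nat \<lfloor>N\<rfloor>}. lam n * e2pi (of_real (\<beta> * real n powr \<theta> + \<alpha> * real n)))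
             \<le> C * N powr (1/2 + \<theta>/2 + \<epsilon>)"
proof -
  have modular: "f ((of_int a * z + of_int b) / (of_int c * z + of_int d)) = (of_int c * z + of_int d) powi k * f z"
    if "a * d - b * c = 1" "z \<in> upper_half_plane" for a b c d :: int and z
    using assms(1) that unfolding hecke_eigenform_def modular_form_def by blast
  obtain C where C: "C > 0" "\<And>z. 0 < Im z \<Longrightarrow> Im z \<le> 1 \<Longrightarrow> norm (f z) \<le> C * Im z powr (- real_of_int k / 2)"
    using cusp_form_bound[OF modular assms(2)] by blast
  obtain D where D: "D > 0"
    "\<And>M \<alpha>. M \<ge> 1 \<Longrightarrow> norm (\<Sum>n\<in>{M div 2<..M}. lam n * cis (2 * pi * (\<beta> * real n powr \<theta> + \<alpha> * real n)))
      \<le> D * (real M powr (1/2) * (sqrt (2 * real M powr \<theta>) + ln (1 + 2 * real M powr (1 - \<theta>))))"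
    using dyadic_block_bound[OF C assms(2,4,5)] by blast
  define E where "E = D * (4 + 1 / \<epsilon>)"
  define \<sigma> where "\<sigma> = 1/2 + \<theta>/2 + \<epsilon>"
  have E: "E \<ge> 0" using D(1) \<open>\<epsilon> > 0\<close> by (simp add: E_def)
  have \<sigma>: "\<sigma> \<ge> 1/2" using assms by (simp add: \<sigma>_def)
  have sum: "norm (\<Sum>n\<in>{1..M}. lam n * cis (2 * pi * (\<beta> * real n powr \<theta> + \<alpha> * real n))) \<le> 4 * E * real M powr \<sigma>" for M \<alpha>
  proof (rule sum_bound_from_dyadic_blocks[OF E \<sigma>])
    fix M :: nat assume M: "M \<ge> 1"
    have "norm (\<Sum>n\<in>{M div 2<..M}. lam n * cis (2 * pi * (\<beta> * real n powr \<theta> + \<alpha> * real n)))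
      \<le> D * (real M powr (1/2) * (sqrt (2 * real M powr \<theta>) + ln (1 + 2 * real M powr (1 - \<theta>))))"
      by (rule D(2)[OF M])
    also have "\<dots> \<le> D * (real M powr (1/2) * ((4 + 1 / \<epsilon>) * real M powr (\<theta> / 2 + \<epsilon>)))"
      using D(1) M assms(4,6) by (intro mult_left_mono sqrt_add_ln_le_powr) auto
    also have "\<dots> = E * (real M powr (1/2) * real M powr (\<theta> / 2 + \<epsilon>))"
      by (simp add: E_def mult_ac)
    also have "real M powr (1/2) * real M powr (\<theta> / 2 + \<epsilon>) = real M powr \<sigma>"
      by (simp only: powr_add[symmetric]) (simp add: \<sigma>_def add.assoc)
    finally show "norm (\<Sum>n\<in>{M div 2<..M}. lam n * cis (2 * pi * (\<beta> * real n powr \<theta> + \<alpha> * real n))) \<le> E * real M powr \<sigma>" .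
  qed
  have e2pi_real: "e2pi (of_real x) = cis (2 * pi * x)" for x
    by (simp add: e2pi_def cis_conv_exp mult_ac)
  show ?thesis
  \<comment> \<open>The witness \<open>4 * E\<close> is fixed before \<open>N\<close> and \<alpha>.
    For \<open>N >= 0\<close> the floor is at most \<open>N\<close>, and the power is monotone
    because its exponent is positive.\<close>
  proof (intro exI eventually_mono[OF eventually_ge_at_top[of 0]] allI)
    fix N \<alpha> :: real assume N: "N \<ge> 0"
    have "norm (\<Sum>n\<in>{1..nat \<lfloor>N\<rfloor>}. lam n * e2pi (of_real (\<beta> * real n powr \<theta> + \<alpha> * real n)))
        \<le> 4 * E * real (nat \<lfloor>N\<rfloor>) powr \<sigma>"
      unfolding e2pi_real by (rule sum)
    also have "\<dots> \<le> 4 * E * N powr (1/2 + \<theta>/2 + \<epsilon>)"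
      using E N \<sigma> by (intro mult_left_mono) (auto simp: \<sigma>_def intro!: powr_mono2)
    finally show "norm (\<Sum>n\<in>{1..nat \<lfloor>N\<rfloor>}. lam n * e2pi (of_real (\<beta> * real n powr \<theta> + \<alpha> * real n)))
        \<le> 4 * E * N powr (1/2 + \<theta>/2 + \<epsilon>)" .
  qed
qed

end
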